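(* Let $n$ be a positive integer and let $j,k\in\{1,2\}$. Suppose that $A=\prod_{i\in n}A_i$ where each $A_i$ is nonempty and closed in $\mathbb{S}$. Then $A$ is $\rho_{k,j}$-Chebyshev in $\mathbb{S}^n$ if and only if $A$ is connected.
   Context: The underlying axiom system is ZF (no form of the axiom of choice is assumed). A positive integer $n$ is identified with $\{0,\dots,n-1\}$. The set $\mathbb{S}$ (symmetrized max-plus algebra). Let $\varepsilon=-\infty$, $\mathbb{R}_\varepsilon=\mathbb{R}\cup\{\varepsilon\}$, $e^{-\infty}=\exp(-\infty)=0$. On $\mathbb{R}_\varepsilon\times\mathbb{R}_\varepsilon$ put $(a,b)\bigtriangledown(c,d)$ iff $\max(a,d)=\max(b,c)$, and put $(a,b)\sim(c,d)$ iff $(a,b)\bigtriangledown(c,d)$ in case $a\neq b$ and $c\neq d$, and iff $(a,b)=(c,d)$ otherwise. Then $\mathbb{S}=(\mathbb{R}_\varepsilon\times\mathbb{R}_\varepsilon)/_\sim$. For $r\in\mathbb{R}_\varepsilon$, the elements $\oplus r$, $\ominus r$, $r^\bullet$ of $\mathbb{S}$ are the classes of $(r,\varepsilon)$, $(\varepsilon,r)$, $(r,r)$. Every element of $\mathbb{S}$ has one of these forms, and the representation is unique except that $\oplus\varepsilon=\ominus\varepsilon=\varepsilon^\bullet$. If $a\in\{\oplus r,\ominus r,r^\bullet\}$, put $|a|=r$ and let $\operatorname{sgn}(a)$ be the corresponding sign $\oplus$, $\ominus$ or $\bullet$ (ambiguous only for $a=\varepsilon^\bullet$, which does not affect the formulas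 below). The canonical embedding $\Phi:\mathbb{S}\to\mathbb{C}$ is $\Phi(\oplus r)=\theta e^r$, $\Phi(\ominus r)=\theta^2e^r$, $\Phi(r^\bullet)=e^r$, where $\theta=\frac{-1+\sqrt3 i}{2}$. The Euclidean distance in $\mathbb{S}$ is $d_1(a,b)=|\Phi(a)-\Phi(b)|$. The inner distance is $d_2(a,b)=\left|\exp|a|-\exp|b|\right|$ if $\operatorname{sgn}(a)=\operatorname{sgn}(b)$ and $d_2(a,b)=\exp|a|+\exp|b|$ if $\operatorname{sgn}(a)\neq\operatorname{sgn}(b)$. The topology of $\mathbb{S}$ is the smallest one making $\Phi$ continuous (both $d_1,d_2$ induce it), and $\mathbb{S}^n$ has the product topology. Metrics on $\mathbb{S}^n$: $\rho_{1,j}(x,y)=\sqrt{\sum_{i\in n}d_j(x(i),y(i))^2}$ and $\rho_{2,j}(x,y)=\sum_{i\in n}d_j(x(i),y(i))$. For a metric space $(X,d)$ and nonempty $K\subseteq X$, let $P_{d,K}(x)=\{y\in K: d(x,y)=d(x,K)\}$ where $d(x,K)=\inf_{y\in K}d(x,y)$; $P_{d,\emptyset}(x)=\emptyset$. $K$ is $d$-Chebyshev in $X$ if $P_{d,K}(x)$ is a singleton for each $x\in X$. *)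

theory Defs
  imports "HOL-Analysis.Analysis"
begin

typedef rmax = "{x::ereal. x \<noteq> \<infinity>}"
  by (rule exI[of _ 0]) simp

setup_lifting type_definition_rmax

instantiation rmax :: linorder
begin

lift_definition less_eq_rmax :: "rmax \<Rightarrow> rmax \<Rightarrow> bool" is "(\<le>)" .

lift_definition less_rmax :: "rmax \<Rightarrow> rmax \<Rightarrow> bool" is "(<)" .

instance
  by standard (transfer; auto)+

end

lift_definition rmax_eps :: rmax is "-\<infinity>" by simp

lift_definition rmax_exp :: "rmax \<Rightarrow> real"
  is "\<lambda>x. if x = -\<infinity> then 0 else exp (real_of_ereal x)" .

lemma rmax_eps_le [simp]: "rmax_eps \<le> r"
  by transfer simp

lemma rmax_eps_less_iff [simp]: "rmax_eps < r \<longleftrightarrow> r \<noteq> rmax_eps"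
  by (metis rmax_eps_le order_le_less order_less_irrefl)

lemma not_less_rmax_eps [simp]: "\<not> r < rmax_eps"
  by (simp add: not_less)

lemma rmax_exp_eps [simp]: "rmax_exp rmax_eps = 0"
  by transfer simp

text \<open>From here on, transfer is to move from classes to pairs over \<open>rmax\<close>, not down to \<open>ereal\<close>.\<close>

lifting_forget rmax.lifting

definition balances :: "rmax \<times> rmax \<Rightarrow> rmax \<times> rmax \<Rightarrow> bool"
  where "balances p q \<longleftrightarrow> max (fst p) (snd q) = max (snd p) (fst q)"

definition smax_rel :: "rmax \<times> rmax \<Rightarrow> rmax \<times> rmax \<Rightarrow> bool"
  where "smax_rel p q \<longleftrightarrow>
    (if fst p \<noteq> snd p \<and> fst q \<noteq> snd q then balances p q else p = q)"

lemma smax_rel_iff: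
  "smax_rel p q \<longleftrightarrow>
     (snd p < fst p \<and> snd q < fst q \<and> fst p = fst q) \<or>
     (fst p < snd p \<and> fst q < snd q \<and> snd p = snd q) \<or>
     (fst p = snd p \<and> p = q)"
  by (cases p; cases q) (auto simp: smax_rel_def balances_def max_def not_le)

quotient_type smax = "rmax \<times> rmax" / smax_rel
proof (rule equivpI)
  show "reflp smax_rel"
    by (auto simp: reflp_def smax_rel_iff)
  show "symp smax_rel"
    by (auto simp: symp_def smax_rel_iff)
  show "transp smax_rel"
  proof (rule transpI)
    fix p q r
    assume pq: "smax_rel p q" and qr: "smax_rel q r"
    consider "snd q < fst q" | "fst q < snd q" | "fst q = snd q"
      by (rule linorder_cases)
    then show "smax_rel p r"
      using pq qr by cases (simp_all add: smax_rel_iff, auto)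
  qed
qed

lift_definition oplus :: "rmax \<Rightarrow> smax" is "\<lambda>r. (r, rmax_eps)" .

lift_definition ominus :: "rmax \<Rightarrow> smax" is "\<lambda>r. (rmax_eps, r)" .

lift_definition bullet :: "rmax \<Rightarrow> smax" is "\<lambda>r. (r, r)" .

datatype smax_sign = Plus | Minus | Balanced

lift_definition smax_abs :: "smax \<Rightarrow> rmax" is "\<lambda>(a, b). max a b"
  by (auto simp: smax_rel_iff max_def)

text \<open>At the zero element, where the sign is ambiguous, the convention is \<open>Balanced\<close>.\<close>

lift_definition smax_sgn :: "smax \<Rightarrow> smax_sign"
  is "\<lambda>(a, b). if b < a then Plus else if a < b then Minus else Balanced"
  by (auto simp: smax_rel_iff)

lemma smax_abs_simps [simp]:
  "smax_abs (oplus r) = r" "smax_abs (ominus r) = r" "smax_abs (bullet r) = r"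
  by (transfer; simp add: max_absorb1 max_absorb2)+

lemma smax_sgn_simps [simp]:
  "r \<noteq> rmax_eps \<Longrightarrow> smax_sgn (oplus r) = Plus"
  "r \<noteq> rmax_eps \<Longrightarrow> smax_sgn (ominus r) = Minus"
  "smax_sgn (bullet r) = Balanced"
  by (transfer; simp)+

lemma oplus_eps: "oplus rmax_eps = bullet rmax_eps"
  by transfer (simp add: smax_rel_iff)

lemma ominus_eps: "ominus rmax_eps = bullet rmax_eps"
  by transfer (simp add: smax_rel_iff)

lemma smax_exhaust:
  obtains r where "a = oplus r" | r where "a = ominus r" | r where "a = bullet r"
proof -
  have *: "\<exists>r. smax_rel p (r, rmax_eps) \<or> smax_rel p (rmax_eps, r) \<or> smax_rel p (r, r)"
    for p :: "rmax \<times> rmax"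
  proof (cases "fst p" "snd p" rule: linorder_cases)
    case less
    then have "smax_rel p (rmax_eps, snd p)"
      by (auto simp: smax_rel_iff intro: order_le_less_trans[OF rmax_eps_le])
    then show ?thesis by blast
  next
    case equal
    then have "smax_rel p (fst p, fst p)"
      by (simp add: smax_rel_iff prod_eq_iff)
    then show ?thesis by blast
  next
    case greater
    then have "smax_rel p (fst p, rmax_eps)"
      by (auto simp: smax_rel_iff intro: order_le_less_trans[OF rmax_eps_le])
    then show ?thesis by blast
  qed
  have "\<exists>r. a = oplus r \<or> a = ominus r \<or> a = bullet r"
    by transfer (rule *)
  with that show thesis by blast
qed

definition theta :: complex
  where "theta = (-1 + complex_of_real (sqrt 3) * \<i>) / 2"

definition smax_embed :: "smax \<Rightarrow> complex"
  where "smax_embed a =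
    (case smax_sgn a of Plus \<Rightarrow> theta | Minus \<Rightarrow> theta\<^sup>2 | Balanced \<Rightarrow> 1)
      * complex_of_real (rmax_exp (smax_abs a))"

lemma smax_embed_simps:
  "smax_embed (oplus r) = theta * complex_of_real (rmax_exp r)"
  "smax_embed (ominus r) = theta\<^sup>2 * complex_of_real (rmax_exp r)"
  "smax_embed (bullet r) = complex_of_real (rmax_exp r)"
  by (cases "r = rmax_eps"; simp add: smax_embed_def)+

definition smax_topology :: "smax topology"
  where "smax_topology = pullback_topology UNIV smax_embed euclidean"

definition smax_dist1 :: "smax \<Rightarrow> smax \<Rightarrow> real"
  where "smax_dist1 a b = cmod (smax_embed a - smax_embed b)"

definition smax_dist2 :: "smax \<Rightarrow> smax \<Rightarrow> real"
  where "smax_dist2 a b =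
    (if smax_sgn a = smax_sgn b
     then \<bar>rmax_exp (smax_abs a) - rmax_exp (smax_abs b)\<bar>
     else rmax_exp (smax_abs a) + rmax_exp (smax_abs b))"

text \<open>The index \<open>j\<close>, and \<open>k\<close> below, is meant to range over \<open>{1, 2}\<close>.\<close>

definition smax_dist :: "nat \<Rightarrow> smax \<Rightarrow> smax \<Rightarrow> real"
  where "smax_dist j = (if j = 1 then smax_dist1 else smax_dist2)"

definition smax_power :: "nat \<Rightarrow> (nat \<Rightarrow> smax) set"
  where "smax_power n = {..<n} \<rightarrow>\<^sub>E UNIV"

definition smax_power_topology :: "nat \<Rightarrow> (nat \<Rightarrow> smax) topology"
  where "smax_power_topology n = product_topology (\<lambda>_. smax_topology) {..<n}"

definition smax_power_dist :: "nat \<Rightarrow> nat \<Rightarrow> nat \<Rightarrow> (nat \<Rightarrow> smax) \<Rightarrow> (nat \<Rightarrow> smax) \<Rightarrow> real"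
  where "smax_power_dist n k j x y =
    (if k = 1 then sqrt (\<Sum>i<n. (smax_dist j (x i) (y i))\<^sup>2)
     else (\<Sum>i<n. smax_dist j (x i) (y i)))"

definition metric_projection :: "('a \<Rightarrow> 'a \<Rightarrow> real) \<Rightarrow> 'a set \<Rightarrow> 'a \<Rightarrow> 'a set"
  where "metric_projection d K x = {y \<in> K. d x y = (INF z\<in>K. d x z)}"

definition chebyshev_in :: "'a set \<Rightarrow> ('a \<Rightarrow> 'a \<Rightarrow> real) \<Rightarrow> 'a set \<Rightarrow> bool"
  where "chebyshev_in X d K \<longleftrightarrow> K \<subseteq> X \<and> (\<forall>x\<in>X. is_singleton (metric_projection d K x))"

end

theory Submission
  imports Defs
begin

text \<open>
  The embedding \<open>smax_embed\<close> identifies \<^typ>\<open>smax\<close> with a tripod: three closed half-lines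
  that issue from the origin of the plane at angles of 120 degrees. The first distance is the
  Euclidean one of the plane, the second is the length of the path inside the tripod.

  That a closed Chebyshev set is connected has nothing to do with the product structure. If a
  closed set \<open>K\<close> is the union of two disjoint nonempty closed parts \<open>U\<close> and \<open>V\<close>, then on a connected
  space the continuous functions given by the distances to \<open>U\<close> and to \<open>V\<close> agree somewhere,
  because the first is the smaller one on \<open>U\<close> and the second on \<open>V\<close>. At such a point a nearest
  point of \<open>U\<close> and a nearest point of \<open>V\<close> are two different nearest points of \<open>K\<close>. Nearest
  points exist because closed balls are compact. This is \<open>connectedin_if_chebyshev_in\<close>.

  Conversely, if the product is connected, so are its factors. In one factor everything rests on
  the signed coordinate along the half-line that contains the given point \<open>x\<close> (positive on that
  half-line, negative on the other two). Both distances from \<open>x\<close> depend only on this coordinate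
  and grow strictly when it moves away from the coordinate of \<open>x\<close>. A connected set containing
  two points \<open>y \<noteq> z\<close> contains, by the intermediate value theorem for such coordinates, a point
  that is nearer to \<open>x\<close> than \<open>y\<close> or nearer than \<open>z\<close>: one of the two themselves, the point \<open>x\<close>,
  or the origin (\<open>nearer_point_in_connectedin\<close>). Two different nearest points in the product
  differ at some index, and replacing that one entry by a nearer one decreases the distance in
  the power, which is impossible.
\<close>

section \<open>Metric projections and connectedness\<close>

lemma mem_metric_projection_iff:
  assumes "\<And>z. z \<in> K \<Longrightarrow> 0 \<le> d x z"
  shows "y \<in> metric_projection d K x \<longleftrightarrow> y \<in> K \<and> (\<forall>z\<in>K. d x y \<le> d x z)"
proof (cases "y \<in> K")
  case True
  have bdd: "bdd_below (d x ` K)"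
    using assms by (intro bdd_belowI2)
  have "(INF z\<in>K. d x z) = d x y" if "\<forall>z\<in>K. d x y \<le> d x z"
    using that True by (intro antisym cINF_lower[OF bdd] cINF_greatest) auto
  then show ?thesis
    using True cINF_lower[OF bdd] by (auto simp: metric_projection_def)
qed (simp add: metric_projection_def)

text \<open>The space itself need not be compact: only the points with a value at most that of one given
  point of \<open>C\<close> compete for the minimum.\<close>
lemma continuous_map_attains_min:
  fixes f :: "'a \<Rightarrow> real"
  assumes "continuous_map X euclideanreal f" "closedin X C" "c \<in> C"
    and "compactin X K" "\<And>y. y \<in> C \<Longrightarrow> f y \<le> f c \<Longrightarrow> y \<in> K"
  shows "\<exists>y\<in>C. \<forall>z\<in>C. f y \<le> f z"
proof -
  have "compact (f ` (C \<inter> K))"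
    using image_compactin[OF closed_Int_compactin[OF assms(2,4)] assms(1)] by simp
  moreover have "f c \<in> f ` (C \<inter> K)"
    using assms(3,5) by auto
  ultimately obtain y where "y \<in> C \<inter> K" and y: "\<forall>z\<in>C \<inter> K. f y \<le> f z"
    using compact_attains_inf[of "f ` (C \<inter> K)"] by blast
  have "f y \<le> f z" if "z \<in> C" for z
  proof (cases "f z \<le> f c")
    case True
    with y that assms(5) show ?thesis by blast
  next
    case False
    have "f y \<le> f c" using y assms(3,5) by blast
    with False show ?thesis by linarith
  qed
  with \<open>y \<in> C \<inter> K\<close> show ?thesis by blast
qed

text \<open>The topology is not assumed to be the one induced by \<open>d\<close>; it is enough that the balls of \<open>d\<close>
  are open, which follows from the continuity of \<open>d\<close> in one argument.\<close>
lemma continuous_map_if_Lipschitz: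
  fixes d :: "'a \<Rightarrow> 'a \<Rightarrow> real" and f :: "'a \<Rightarrow> real"
  assumes cont: "\<And>x. x \<in> topspace X \<Longrightarrow> continuous_map X euclideanreal (d x)"
    and refl: "\<And>x. x \<in> topspace X \<Longrightarrow> d x x = 0"
    and Lip: "\<And>x y. x \<in> topspace X \<Longrightarrow> y \<in> topspace X \<Longrightarrow> \<bar>f x - f y\<bar> \<le> d x y"
  shows "continuous_map X euclideanreal f"
  unfolding continuous_map
proof (intro conjI allI impI)
  fix U :: "real set" assume "openin euclidean U"
  show "openin X {x \<in> topspace X. f x \<in> U}"
  proof (subst openin_subopen, intro ballI)
    fix x assume x: "x \<in> {x \<in> topspace X. f x \<in> U}"
    with \<open>openin euclidean U\<close> obtain e where e: "e > 0" "ball (f x) e \<subseteq> U"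
      by (auto simp: open_contains_ball)
    have "openin X {y \<in> topspace X. d x y \<in> {..<e}}"
      using x by (intro openin_continuous_map_preimage[OF cont]) auto
    moreover have "f y \<in> U" if "y \<in> topspace X" "d x y < e" for y
      using Lip[of x y] x that e by (auto simp: dist_real_def subset_iff)
    ultimately show "\<exists>T. openin X T \<and> x \<in> T \<and> T \<subseteq> {x \<in> topspace X. f x \<in> U}"
      using x e refl by (intro exI[of _ "{y \<in> topspace X. d x y \<in> {..<e}}"]) auto
  qed
qed auto

text \<open>If \<open>K\<close> splits into two closed parts, some point of the connected space is equally far from
  both parts, and then it has a nearest point in each of them.\<close>
lemma connectedin_if_chebyshev_in:
  fixes d :: "'a \<Rightarrow> 'a \<Rightarrow> real"
  assumes X: "connected_space X"
    and cont: "\<And>x. x \<in> topspace X \<Longrightarrow> continuous_map X euclideanreal (d x)"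
    and nonneg: "\<And>x y. 0 \<le> d x y"
    and refl: "\<And>x. d x x = 0"
    and sym: "\<And>x y. d x y = d y x"
    and triangle: "\<And>x y z. d x z \<le> d x y + d y z"
    and attains: "\<And>C x. closedin X C \<Longrightarrow> C \<noteq> {} \<Longrightarrow> x \<in> topspace X \<Longrightarrow> \<exists>y\<in>C. \<forall>z\<in>C. d x y \<le> d x z"
    and K: "closedin X K" "chebyshev_in (topspace X) d K"
  shows "connectedin X K"
proof (rule ccontr)
  assume "\<not> connectedin X K"
  then obtain E F where EF: "closedin X E" "closedin X F" "K \<subseteq> E \<union> F"
    "E \<inter> F \<inter> K = {}" "E \<inter> K \<noteq> {}" "F \<inter> K \<noteq> {}"
    using closedin_subset[OF K(1)] unfolding connectedin_closedin by blast
  \<comment> \<open>Choosing a nearest point \<open>p x\<close> expresses the distance from \<open>x\<close> to \<open>C\<close> as \<open>d x (p x)\<close>, which is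
    Lipschitz in \<open>x\<close> although \<open>p\<close> may be discontinuous.\<close>
  have nearest: "\<exists>p. (\<forall>x\<in>topspace X. p x \<in> C \<and> (\<forall>z\<in>C. d x (p x) \<le> d x z)) \<and>
      continuous_map X euclideanreal (\<lambda>x. d x (p x))" if C: "closedin X C" "C \<noteq> {}" for C
  proof -
    obtain p where p: "\<forall>x\<in>topspace X. p x \<in> C \<and> (\<forall>z\<in>C. d x (p x) \<le> d x z)"
      using bchoice[of "topspace X" "\<lambda>x y. y \<in> C \<and> (\<forall>z\<in>C. d x y \<le> d x z)"] attains[OF C] by blast
    have Lip: "d x (p x) \<le> d x y + d y (p y)" if "x \<in> topspace X" "y \<in> topspace X" for x y
    proof -
      have "d x (p x) \<le> d x (p y)" using p that by blast
      then show ?thesis using triangle[of x "p y" y] by linarith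
    qed
    have "continuous_map X euclideanreal (\<lambda>x. d x (p x))"
    proof (rule continuous_map_if_Lipschitz[OF cont refl])
      show "\<bar>d x (p x) - d y (p y)\<bar> \<le> d x y" if "x \<in> topspace X" "y \<in> topspace X" for x y
        using Lip[OF that] Lip[OF that(2,1)] sym[of x y] by linarith
    qed
    with p show ?thesis by blast
  qed
  have "closedin X (E \<inter> K)" "closedin X (F \<inter> K)"
    using EF K by auto
  from nearest[OF this(1)] nearest[OF this(2)] EF(5,6)
  obtain p q where p: "\<forall>x\<in>topspace X. p x \<in> E \<inter> K \<and> (\<forall>z\<in>E \<inter> K. d x (p x) \<le> d x z)"
      and contp: "continuous_map X euclideanreal (\<lambda>x. d x (p x))"
      and q: "\<forall>x\<in>topspace X. q x \<in> F \<inter> K \<and> (\<forall>z\<in>F \<inter> K. d x (q x) \<le> d x z)"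
      and contq: "continuous_map X euclideanreal (\<lambda>x. d x (q x))"
    by blast
  define W where "W = {x \<in> topspace X. d x (p x) - d x (q x) \<in> {..0}}"
  define W' where "W' = {x \<in> topspace X. d x (p x) - d x (q x) \<in> {0..}}"
  have "closedin X W" "closedin X W'"
    unfolding W_def W'_def
    by (intro closedin_continuous_map_preimage[OF continuous_map_diff[OF contp contq]]; simp)+
  moreover have "topspace X \<subseteq> W \<union> W'"
    by (auto simp: W_def W'_def)
  moreover have "W \<noteq> {}"
  proof -
    obtain x where x: "x \<in> E \<inter> K" using EF by blast
    then have "x \<in> topspace X" using closedin_subset[OF K(1)] by blast
    moreover from this have "d x (p x) \<le> d x x" using p x by blast
    ultimately have "x \<in> W" using refl[of x] nonneg[of x "q x"] by (simp add: W_def)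
    then show ?thesis by blast
  qed
  moreover have "W' \<noteq> {}"
  proof -
    obtain x where x: "x \<in> F \<inter> K" using EF by blast
    then have "x \<in> topspace X" using closedin_subset[OF K(1)] by blast
    moreover from this have "d x (q x) \<le> d x x" using q x by blast
    ultimately have "x \<in> W'" using refl[of x] nonneg[of x "p x"] by (simp add: W'_def)
    then show ?thesis by blast
  qed
  ultimately have "W \<inter> W' \<noteq> {}"
    using X unfolding connected_space_closedin by blast
  then obtain x where x: "x \<in> topspace X" "d x (p x) = d x (q x)"
    by (auto simp: W_def W'_def)
  have "d x (p x) \<le> d x z" if "z \<in> K" for z
  proof (cases "z \<in> E")
    case True
    with p x that show ?thesis by blast
  next
    case False
    with EF(3) q x that show ?thesis by auto
  qed
  moreover have "p x \<in> E \<inter> K" "q x \<in> F \<inter> K"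
    using p q x by blast+
  ultimately have "p x \<in> metric_projection d K x" "q x \<in> metric_projection d K x"
    using x by (simp_all add: mem_metric_projection_iff nonneg)
  moreover have "is_singleton (metric_projection d K x)"
    using K x by (simp add: chebyshev_in_def)
  ultimately have "p x = q x"
    by (auto simp: is_singleton_def)
  with \<open>p x \<in> E \<inter> K\<close> \<open>q x \<in> F \<inter> K\<close> EF(4) show False by auto
qed

section \<open>The tripod\<close>

definition rmax_log :: "real \<Rightarrow> rmax" where
  "rmax_log t = Abs_rmax (if t = 0 then -\<infinity> else ereal (ln t))"

lemma Rep_rmax_log: "Rep_rmax (rmax_log t) = (if t = 0 then -\<infinity> else ereal (ln t))"
  unfolding rmax_log_def by (rule Abs_rmax_inverse) simp

lemma rmax_exp_log: "t \<ge> 0 \<Longrightarrow> rmax_exp (rmax_log t) = t"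
  by (simp add: rmax_exp.rep_eq Rep_rmax_log)

lemma rmax_log_exp: "rmax_log (rmax_exp r) = r"
proof -
  have "Rep_rmax r \<noteq> \<infinity>" using Rep_rmax[of r] by simp
  then have "Rep_rmax (rmax_log (rmax_exp r)) = Rep_rmax r"
    by (cases "Rep_rmax r") (auto simp: rmax_exp.rep_eq Rep_rmax_log)
  then show ?thesis by (simp add: Rep_rmax_inject)
qed

lemma rmax_exp_nonneg: "rmax_exp r \<ge> 0"
  by (simp add: rmax_exp.rep_eq)

lemma rmax_log_eq_eps: "rmax_log t = rmax_eps \<longleftrightarrow> t = 0"
  by (simp add: Rep_rmax_inject[symmetric] Rep_rmax_log rmax_eps.rep_eq)

definition direction :: "smax_sign \<Rightarrow> complex" where
  "direction s = (case s of Plus \<Rightarrow> theta | Minus \<Rightarrow> theta\<^sup>2 | Balanced \<Rightarrow> 1)"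

lemma finite_smax_sign: "finite (UNIV :: smax_sign set)"
proof (rule finite_subset)
  show "(UNIV :: smax_sign set) \<subseteq> {Plus, Minus, Balanced}"
    using smax_sign.exhaust by blast
qed simp

text \<open>Polar coordinates on the tripod, with the sign in the role of the angle and the exponential of
  the absolute value, hence a nonnegative real, as the radius; they are unique except at the
  origin.\<close>
fun ray :: "smax_sign \<Rightarrow> real \<Rightarrow> smax" where
  "ray Plus t = oplus (rmax_log t)"
| "ray Minus t = ominus (rmax_log t)"
| "ray Balanced t = bullet (rmax_log t)"

lemma ray_cases:
  obtains s t where "t \<ge> 0" "x = ray s t"
proof (rule smax_exhaust[of x])
  fix r
  show ?thesis if "x = oplus r"
    using that \<open>\<And>t s. 0 \<le> t \<Longrightarrow> x = ray s t \<Longrightarrow> thesis\<close>[of "rmax_exp r" Plus]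
    by (simp add: rmax_log_exp rmax_exp_nonneg)
  show ?thesis if "x = ominus r"
    using that \<open>\<And>t s. 0 \<le> t \<Longrightarrow> x = ray s t \<Longrightarrow> thesis\<close>[of "rmax_exp r" Minus]
    by (simp add: rmax_log_exp rmax_exp_nonneg)
  show ?thesis if "x = bullet r"
    using that \<open>\<And>t s. 0 \<le> t \<Longrightarrow> x = ray s t \<Longrightarrow> thesis\<close>[of "rmax_exp r" Balanced]
    by (simp add: rmax_log_exp rmax_exp_nonneg)
qed

lemma smax_embed_ray: "t \<ge> 0 \<Longrightarrow> smax_embed (ray s t) = direction s * t"
  by (cases s) (simp_all add: direction_def smax_embed_simps rmax_exp_log)

lemma smax_abs_ray: "smax_abs (ray s t) = rmax_log t"
  by (cases s) simp_all

lemma ray_zero: "ray s 0 = ray s' 0"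
proof -
  have "ray s 0 = bullet rmax_eps" for s
    using rmax_log_eq_eps[of 0] by (cases s) (simp_all add: oplus_eps ominus_eps)
  then show ?thesis by simp
qed

lemma smax_sgn_ray: "smax_sgn (ray s t) = (if t = 0 then Balanced else s)"
proof (cases "t = 0")
  case True
  then show ?thesis using ray_zero[of s Balanced] by simp
next
  case False
  then show ?thesis by (cases s) (simp_all add: rmax_log_eq_eps)
qed

lemma theta_Re_Im: "Re theta = -1/2" "Im theta = sqrt 3 / 2" "Re (theta\<^sup>2) = -1/2" "Im (theta\<^sup>2) = - sqrt 3 / 2"
  by (simp_all add: theta_def power2_eq_square)

lemma direction_Re_Im:
  "Re (direction s) = (if s = Balanced then 1 else - 1 / 2)"
  "Im (direction s) = (case s of Plus \<Rightarrow> sqrt 3 / 2 | Minus \<Rightarrow> - sqrt 3 / 2 | Balanced \<Rightarrow> 0)"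
  by (cases s; simp add: direction_def theta_Re_Im)+

lemma Re_cnj_direction:
  "Re (cnj (direction s) * direction s') = (if s = s' then 1 else -1/2)"
  by (cases s; cases s') (simp_all add: direction_Re_Im)

text \<open>The law of cosines, with angle 0 or 120 degrees.\<close>
lemma cmod_direction_diff:
  fixes a b :: real
  shows "(cmod (direction s * a - direction s' * b))\<^sup>2
    = (if s = s' then (a - b)\<^sup>2 else a\<^sup>2 + a * b + b\<^sup>2)"
proof -
  have "(cmod (direction s * a - direction s' * b))\<^sup>2
     = (Re (direction s) * a - Re (direction s') * b)\<^sup>2 + (Im (direction s) * a - Im (direction s') * b)\<^sup>2"
    by (simp add: cmod_power2)
  also have "\<dots> = (if s = s' then (a - b)\<^sup>2 else a\<^sup>2 + a * b + b\<^sup>2)"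
    unfolding direction_Re_Im
    by (cases s; cases s') (simp_all add: power2_eq_square algebra_simps)
  finally show ?thesis .
qed

lemma smax_dist_ray:
  assumes "a \<ge> 0" "b \<ge> 0"
  shows "smax_dist j (ray s a) (ray s' b) =
    (if s = s' then \<bar>a - b\<bar> else if j = 1 then sqrt (a\<^sup>2 + a * b + b\<^sup>2) else a + b)"
proof (cases "j = 1")
  case True
  have "smax_dist j (ray s a) (ray s' b) = sqrt ((cmod (direction s * a - direction s' * b))\<^sup>2)"
    using assms True by (simp add: smax_dist_def smax_dist1_def smax_embed_ray)
  then show ?thesis
    using True by (simp only: cmod_direction_diff) auto
next
  case False
  then show ?thesis
    using assms by (auto simp: smax_dist_def smax_dist2_def smax_abs_ray smax_sgn_ray rmax_exp_log)
qed

text \<open>The signed coordinate along the half-line \<open>s\<close>, which is \<open>t\<close> at \<open>ray s t\<close> and \<open>- t\<close> at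
  \<open>ray s' t\<close> for the other signs. Orthogonal projection to the line spanned by the half-line \<open>s\<close> gives
  \<open>p = t\<close> and \<open>p = - t / 2\<close> respectively; taking the minimum of \<open>p\<close> and \<open>2 * p\<close> corrects the factor, and
  makes the continuity evident.\<close>
definition ray_coord :: "smax_sign \<Rightarrow> smax \<Rightarrow> real" where
  "ray_coord s x = (let p = Re (cnj (direction s) * smax_embed x) in min p (2 * p))"

lemma ray_coord_ray: "t \<ge> 0 \<Longrightarrow> ray_coord s (ray s' t) = (if s = s' then t else - t)"
proof -
  assume t: "t \<ge> 0"
  have "Re (cnj (direction s) * (direction s' * t)) = Re (cnj (direction s) * direction s') * t"
    by (simp add: algebra_simps)
  then show ?thesis
    using t by (simp add: ray_coord_def smax_embed_ray Re_cnj_direction del: complex_cnj_mult times_complex.sel)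
qed

lemma continuous_map_smax_embed: "continuous_map smax_topology euclidean smax_embed"
  unfolding smax_topology_def by (metis continuous_map_id continuous_map_pullback comp_id id_comp)

lemma topspace_smax_topology [simp]: "topspace smax_topology = UNIV"
  by (simp add: smax_topology_def topspace_pullback_topology)

lemma continuous_map_compose_smax_embed:
  assumes "continuous_on UNIV f"
  shows "continuous_map smax_topology euclidean (\<lambda>x. f (smax_embed x))"
  using continuous_map_compose[OF continuous_map_smax_embed, of euclidean f] assms
  by (simp add: comp_def)

lemma continuous_map_ray_coord: "continuous_map smax_topology euclideanreal (ray_coord s)"
  unfolding ray_coord_def Let_def
  by (rule continuous_map_compose_smax_embed) (intro continuous_intros)

text \<open>The inner distances from a point of the half-line \<open>s\<close> do not change when the other two
  half-lines are glued together, which turns the tripod into a real line.\<close>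
lemma smax_dist2_ray: "a \<ge> 0 \<Longrightarrow> smax_dist2 (ray s a) x = \<bar>a - ray_coord s x\<bar>"
  using smax_dist_ray[of a _ 2 s]
  by (cases x rule: ray_cases) (auto simp: smax_dist_def ray_coord_ray)

lemma continuous_map_smax_dist: "continuous_map smax_topology euclideanreal (smax_dist j x)"
proof (cases "j = 1")
  case True
  have "continuous_map smax_topology euclideanreal (\<lambda>y. cmod (smax_embed x - smax_embed y))"
    by (rule continuous_map_compose_smax_embed) (intro continuous_intros)
  then show ?thesis using True by (simp add: smax_dist_def smax_dist1_def[abs_def])
next
  case False
  obtain s a where "a \<ge> 0" "x = ray s a" by (rule ray_cases)
  then have "smax_dist j x = (\<lambda>y. \<bar>a - ray_coord s y\<bar>)"
    using False by (auto simp: smax_dist_def smax_dist2_ray)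
  then show ?thesis
    by (simp add: continuous_map_real_abs continuous_map_diff continuous_map_ray_coord)
qed

lemma continuous_map_ray: "continuous_map (top_of_set {0..}) smax_topology (ray s)"
  unfolding smax_topology_def
proof (rule continuous_map_pullback')
  have "continuous_on {0..} (\<lambda>t. direction s * complex_of_real t)"
    by (intro continuous_intros)
  then have "continuous_on {0..} (smax_embed \<circ> ray s)"
    by (rule continuous_on_eq) (simp add: smax_embed_ray)
  then show "continuous_map (top_of_set {0..}) euclidean (smax_embed \<circ> ray s)"
    by simp
qed auto

text \<open>The three half-lines meet at the origin.\<close>
lemma connected_space_smax: "connected_space smax_topology"
proof -
  have "connectedin smax_topology (\<Union>s. ray s ` {0..})"
  proof (rule connectedin_Union)
    have "connectedin smax_topology (ray s ` {0..})" for s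
      by (rule connectedin_continuous_map_image[OF continuous_map_ray])
        (simp add: connectedin_subtopology)
    then show "connectedin smax_topology S" if "S \<in> range (\<lambda>s. ray s ` {0..})" for S
      using that by blast
    have "ray Balanced 0 \<in> ray s ` {0..}" for s
      using ray_zero[of Balanced s] by simp
    then show "\<Inter> (range (\<lambda>s. ray s ` {0..})) \<noteq> {}"
      by blast
  qed
  moreover have "(\<Union>s. ray s ` {0..}) = UNIV"
  proof -
    have "x \<in> (\<Union>s. ray s ` {0..})" for x
    proof -
      obtain s t where "0 \<le> t" "x = ray s t" by (rule ray_cases)
      then show ?thesis by blast
    qed
    then show ?thesis by blast
  qed
  ultimately show ?thesis
    using connectedin_topspace[of smax_topology] by simp
qed

text \<open>Such a ball consists of three segments, each the continuous image of a compact interval.\<close>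
lemma compactin_smax_cball: "compactin smax_topology {x. cmod (smax_embed x) \<le> r}"
proof -
  have "cmod (direction s) = 1" for s
    using cmod_direction_diff[of s 1 s 0] by (simp add: abs_square_eq_1)
  then have norm_ray: "cmod (smax_embed (ray s t)) = t" if "t \<ge> 0" for s t
    using that by (simp add: smax_embed_ray norm_mult)
  have "{x. cmod (smax_embed x) \<le> r} = (\<Union>s. ray s ` {0..r})" (is "_ = ?U")
  proof (intro equalityI subsetI)
    fix x assume "x \<in> {x. cmod (smax_embed x) \<le> r}"
    moreover obtain s t where "0 \<le> t" "x = ray s t" by (rule ray_cases)
    ultimately have "t \<in> {0..r}" by (simp add: norm_ray)
    with \<open>x = ray s t\<close> show "x \<in> ?U" by blast
  next
    fix x assume "x \<in> ?U"
    then obtain s t where "x = ray s t" "0 \<le> t" "t \<le> r" by auto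
    then show "x \<in> {x. cmod (smax_embed x) \<le> r}"
      by (simp add: norm_ray)
  qed
  moreover have "compactin smax_topology ?U"
  proof (rule compactin_Union)
    have "compactin smax_topology (ray s ` {0..r})" for s
      by (rule image_compactin[OF _ continuous_map_ray]) (simp add: compactin_subtopology)
    then show "compactin smax_topology S" if "S \<in> range (\<lambda>s. ray s ` {0..r})" for S
      using that by blast
  qed (simp add: finite_smax_sign)
  ultimately show ?thesis by simp
qed

section \<open>Distances in the tripod\<close>

lemma smax_dist_sym: "smax_dist j x y = smax_dist j y x"
  by (simp add: smax_dist_def smax_dist1_def smax_dist2_def norm_minus_commute abs_minus_commute)

lemma smax_dist_nonneg: "0 \<le> smax_dist j x y"
  by (simp add: smax_dist_def smax_dist1_def smax_dist2_def rmax_exp_nonneg)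

lemma smax_dist_refl: "smax_dist j x x = 0"
  by (simp add: smax_dist_def smax_dist1_def smax_dist2_def)

lemma smax_dist_triangle: "smax_dist j x z \<le> smax_dist j x y + smax_dist j y z"
proof (cases "j = 1")
  case True
  then show ?thesis
    using norm_triangle_ineq[of "smax_embed x - smax_embed y" "smax_embed y - smax_embed z"]
    by (simp add: smax_dist_def smax_dist1_def)
next
  case False
  then show ?thesis
    using rmax_exp_nonneg[of "smax_abs x"] rmax_exp_nonneg[of "smax_abs y"] rmax_exp_nonneg[of "smax_abs z"]
    by (auto simp: smax_dist_def smax_dist2_def)
qed

text \<open>For a point at distance \<open>t\<close> from the origin on another half-line, the Euclidean distance from
  \<open>ray s a\<close> is the square root of \<open>a\<^sup>2 + a * t + t\<^sup>2\<close>. It increases with \<open>t\<close> and equals \<open>a\<close> at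
  the origin, so that the Euclidean distance is monotone on each side of \<open>a\<close> just like the inner
  one.\<close>
lemma smax_dist_strict_mono_ray_coord:
  assumes a: "a \<ge> 0"
    and closer: "ray_coord s z < ray_coord s y \<and> ray_coord s y \<le> a \<or> a \<le> ray_coord s y \<and> ray_coord s y < ray_coord s z"
  shows "smax_dist j (ray s a) y < smax_dist j (ray s a) z"
proof (cases "j = 1")
  case False
  then show ?thesis
    using assms by (auto simp: smax_dist_def smax_dist2_ray)
next
  case True
  obtain t b u c where y: "y = ray t b" "b \<ge> 0" and z: "z = ray u c" "c \<ge> 0"
    by (metis ray_cases)
  show ?thesis
  proof (cases "s = u")
    case True
    show ?thesis
    proof (cases "s = t")
      case False
      with True closer y z a have "a = 0" "b = 0" "0 < c"
        by (auto simp: ray_coord_ray)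
      with True False y z show ?thesis by (simp add: smax_dist_ray)
    qed (use True closer y z a in \<open>auto simp: smax_dist_ray ray_coord_ray\<close>)
  next
    case u: False
    show ?thesis
    proof (cases "s = t")
      case True
      with closer y z u a have b: "- c < b" "b \<le> a" "b \<ge> 0"
        by (auto simp: ray_coord_ray)
      have "(a - b)\<^sup>2 < a\<^sup>2 + a * c + c\<^sup>2"
      proof (cases "c = 0")
        case True
        with b have "b > 0" by simp
        have "(a - b)\<^sup>2 < a\<^sup>2" using b \<open>b > 0\<close> by (intro power_strict_mono) auto
        with True show ?thesis by simp
      next
        case False
        then have "c\<^sup>2 > 0" by simp
        moreover have "(a - b)\<^sup>2 \<le> a\<^sup>2" using b by (intro power_mono) auto
        moreover have "a * c \<ge> 0" using a z by simp
        ultimately show ?thesis by linarith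
      qed
      then have "\<bar>a - b\<bar> < sqrt (a\<^sup>2 + a * c + c\<^sup>2)"
        using b by (simp add: real_less_rsqrt)
      with True u \<open>j = 1\<close> y z a show ?thesis by (simp add: smax_dist_ray)
    next
      case False
      with closer y z u a have "b < c" by (auto simp: ray_coord_ray)
      then have "a * b \<le> a * c" "b\<^sup>2 < c\<^sup>2"
        using a y by (auto intro: mult_left_mono power_strict_mono)
      with False u \<open>j = 1\<close> y z a show ?thesis by (simp add: smax_dist_ray)
    qed
  qed
qed

lemma eq_ray_ray_coord: "0 \<le> ray_coord s x \<Longrightarrow> x = ray s (ray_coord s x)"
proof -
  assume nonneg: "0 \<le> ray_coord s x"
  obtain t b where x: "x = ray t b" "b \<ge> 0" by (metis ray_cases)
  show ?thesis
  proof (cases "s = t")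
    case False
    with nonneg x have "b = 0" by (simp add: ray_coord_ray)
    with x show ?thesis using ray_zero[of t s] by (simp add: ray_coord_ray)
  qed (use x in \<open>simp add: ray_coord_ray\<close>)
qed

text \<open>The intermediate value theorem gives a point of \<open>C\<close> with coordinate \<open>a\<close>. A negative coordinate
  is shared by two points of the tripod, but a nonnegative one determines the point.\<close>
lemma ray_in_connectedin:
  assumes C: "connectedin smax_topology C" "y \<in> C" "z \<in> C"
    and a: "0 \<le> a" "ray_coord s y \<le> a" "a \<le> ray_coord s z"
  shows "ray s a \<in> C"
proof -
  have "connected (ray_coord s ` C)"
    using connectedin_continuous_map_image[OF continuous_map_ray_coord C(1)] by simp
  then have "a \<in> ray_coord s ` C"
    by (rule connectedD_interval[OF _ imageI[OF C(2)] imageI[OF C(3)] a(2,3)])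
  then obtain x where "x \<in> C" "ray_coord s x = a" by blast
  then show ?thesis using eq_ray_ray_coord[of s x] a by simp
qed

text \<open>This replaces the strict convexity that gives uniqueness of nearest points in Euclidean
  space. The nearer point can be taken to be the median of \<open>x\<close>, \<open>y\<close> and \<open>z\<close> in the tripod, or
  \<open>y\<close> or \<open>z\<close> itself.\<close>
lemma nearer_point_in_connectedin:
  assumes C: "connectedin smax_topology C" "y \<in> C" "z \<in> C" and "y \<noteq> z"
  shows "\<exists>m\<in>C. smax_dist j x m < smax_dist j x y \<or> smax_dist j x m < smax_dist j x z"
proof -
  obtain s a where x: "x = ray s a" and a: "a \<ge> 0" by (metis ray_cases)
  have less: "\<exists>m\<in>C. smax_dist j x m < smax_dist j x y \<or> smax_dist j x m < smax_dist j x z"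
    if "y \<in> C" "z \<in> C" and lt: "ray_coord s y < ray_coord s z" for y z
  proof -
    consider "a \<le> ray_coord s y" | "ray_coord s z \<le> a" | "ray_coord s y < a" "a < ray_coord s z"
      by linarith
    then show ?thesis
    proof cases
      case 3
      \<comment> \<open>Here \<open>x\<close> separates \<open>y\<close> from \<open>z\<close>, and hence belongs to \<open>C\<close>.\<close>
      then have "x \<in> C" using ray_in_connectedin[OF C(1) that(1,2) a, of s] x by simp
      moreover have "smax_dist j x x < smax_dist j x y"
        using smax_dist_strict_mono_ray_coord[OF a, of s y x] 3 x a by (simp add: ray_coord_ray)
      ultimately show ?thesis by blast
    qed (use that smax_dist_strict_mono_ray_coord[OF a] x in blast)+
  qed
  consider "ray_coord s y < ray_coord s z" | "ray_coord s z < ray_coord s y" | "ray_coord s y = ray_coord s z"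
    by linarith
  then show ?thesis
  proof cases
    case 1 then show ?thesis using less C by blast
  next
    case 2 then show ?thesis using less C by blast
  next
    case 3
    \<comment> \<open>Equal coordinates of different points are negative: \<open>y\<close> and \<open>z\<close> lie on the two half-lines
      away from \<open>x\<close>, and the origin separates them.\<close>
    then have neg: "ray_coord s y < 0"
      using eq_ray_ray_coord[of s y] eq_ray_ray_coord[of s z] \<open>y \<noteq> z\<close> by force
    obtain t b u c where y: "y = ray t b" "b \<ge> 0" and z: "z = ray u c" "c \<ge> 0"
      by (metis ray_cases)
    with 3 neg \<open>y \<noteq> z\<close> have "t \<noteq> u" "b = c"
      by (auto simp: ray_coord_ray split: if_splits)
    then have "ray t 0 \<in> C"
      using ray_in_connectedin[OF C(1,3,2), of 0 t] y z by (simp add: ray_coord_ray)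
    moreover have "ray_coord s (ray t 0) = 0"
      by (simp add: ray_coord_ray)
    then have "smax_dist j x (ray t 0) < smax_dist j x y"
      unfolding x using neg a by (intro smax_dist_strict_mono_ray_coord) auto
    ultimately show ?thesis by blast
  qed
qed

section \<open>Finite powers of the tripod\<close>

lemma smax_power_dist_eq_L2_set:
  "k = 1 \<Longrightarrow> smax_power_dist n k j x y = L2_set (\<lambda>i. smax_dist j (x i) (y i)) {..<n}"
  by (simp add: smax_power_dist_def L2_set_def)

lemma smax_power_dist_nonneg: "0 \<le> smax_power_dist n k j x y"
  by (simp add: smax_power_dist_def sum_nonneg smax_dist_nonneg)

lemma smax_power_dist_refl: "smax_power_dist n k j x x = 0"
  by (simp add: smax_power_dist_def smax_dist_refl)

lemma smax_power_dist_sym: "smax_power_dist n k j x y = smax_power_dist n k j y x"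
  by (simp add: smax_power_dist_def smax_dist_sym)

lemma smax_power_dist_triangle:
  "smax_power_dist n k j x z \<le> smax_power_dist n k j x y + smax_power_dist n k j y z"
proof (cases "k = 1")
  case True
  have "L2_set (\<lambda>i. smax_dist j (x i) (z i)) {..<n}
      \<le> L2_set (\<lambda>i. smax_dist j (x i) (y i) + smax_dist j (y i) (z i)) {..<n}"
    by (rule L2_set_mono) (simp_all add: smax_dist_triangle smax_dist_nonneg)
  also have "\<dots> \<le> L2_set (\<lambda>i. smax_dist j (x i) (y i)) {..<n} + L2_set (\<lambda>i. smax_dist j (y i) (z i)) {..<n}"
    by (rule L2_set_triangle_ineq)
  finally show ?thesis by (simp add: True smax_power_dist_eq_L2_set)
next
  case False
  then show ?thesis
    by (simp add: smax_power_dist_def sum_mono smax_dist_triangle flip: sum.distrib)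
qed

lemma smax_dist_le_smax_power_dist:
  assumes "i < n"
  shows "smax_dist j (x i) (y i) \<le> smax_power_dist n k j x y"
proof (cases "k = 1")
  case True
  then show ?thesis
    using assms member_le_L2_set[of "{..<n}" i "\<lambda>i. smax_dist j (x i) (y i)"] by (simp add: smax_power_dist_eq_L2_set)
next
  case False
  then show ?thesis
    using assms member_le_sum[of i "{..<n}" "\<lambda>i. smax_dist j (x i) (y i)"]
    by (simp add: smax_power_dist_def smax_dist_nonneg)
qed

text \<open>Minimisation in a product is coordinatewise: an improvement in one entry improves the
  whole.\<close>
lemma smax_power_dist_upd_less:
  assumes "i < n" "smax_dist j (x i) m < smax_dist j (x i) (y i)"
  shows "smax_power_dist n k j x (y(i := m)) < smax_power_dist n k j x y"
proof -
  have "(\<Sum>l<n. smax_dist j (x l) ((y(i := m)) l)) < (\<Sum>l<n. smax_dist j (x l) (y l))"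
    using assms by (intro sum_strict_mono_ex1) auto
  moreover have "(\<Sum>l<n. (smax_dist j (x l) ((y(i := m)) l))\<^sup>2) < (\<Sum>l<n. (smax_dist j (x l) (y l))\<^sup>2)"
    using assms by (intro sum_strict_mono_ex1) (auto intro!: power_strict_mono power_mono smax_dist_nonneg)
  ultimately show ?thesis by (simp add: smax_power_dist_def)
qed

lemma topspace_smax_power_topology: "topspace (smax_power_topology n) = smax_power n"
  by (simp add: smax_power_topology_def smax_power_def)

lemma continuous_map_smax_power_dist:
  "continuous_map (smax_power_topology n) euclideanreal (smax_power_dist n k j x)"
proof -
  have coord: "continuous_map (smax_power_topology n) euclideanreal (\<lambda>y. smax_dist j (x i) (y i))"
    if "i < n" for i
    using continuous_map_compose[OF continuous_map_product_projection[of i "{..<n}" "\<lambda>_. smax_topology"]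
      continuous_map_smax_dist[of j "x i"]] that
    by (simp add: smax_power_topology_def comp_def)
  show ?thesis
  proof (cases "k = 1")
    case True
    have "continuous_map (smax_power_topology n) euclideanreal (\<lambda>y. sqrt (\<Sum>i<n. (smax_dist j (x i) (y i))\<^sup>2))"
      by (intro continuous_map_sqrt continuous_map_sum continuous_map_real_pow coord) auto
    with True show ?thesis by (simp add: smax_power_dist_def[abs_def])
  next
    case False
    have "continuous_map (smax_power_topology n) euclideanreal (\<lambda>y. \<Sum>i<n. smax_dist j (x i) (y i))"
      by (intro continuous_map_sum coord) auto
    with False show ?thesis by (simp add: smax_power_dist_def[abs_def])
  qed
qed

text \<open>A straight segment is no longer than the path through the origin. The consequence of
  interest is that balls of either distance are bounded in the plane.\<close>
lemma cmod_smax_embed_diff_le: "cmod (smax_embed x - smax_embed y) \<le> smax_dist j x y"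
proof -
  have "smax_dist 1 (ray s a) (ray t b) \<le> smax_dist j (ray s a) (ray t b)" if "a \<ge> 0" "b \<ge> 0" for s t a b
  proof -
    have "a\<^sup>2 + a * b + b\<^sup>2 \<le> (a + b)\<^sup>2" using that by (simp add: power2_sum)
    then have "sqrt (a\<^sup>2 + a * b + b\<^sup>2) \<le> a + b" using that by (simp add: real_le_lsqrt)
    with that show ?thesis by (simp add: smax_dist_ray)
  qed
  then have "smax_dist 1 x y \<le> smax_dist j x y" by (metis ray_cases)
  then show ?thesis by (simp add: smax_dist_def smax_dist1_def)
qed

text \<open>Points at least as near to \<open>x\<close> as a given point \<open>c\<close> lie in a product of closed balls about the
  origin of the tripod, which is compact.\<close>
lemma smax_power_dist_attains_min:
  assumes "closedin (smax_power_topology n) C" "C \<noteq> {}"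
  shows "\<exists>y\<in>C. \<forall>z\<in>C. smax_power_dist n k j x y \<le> smax_power_dist n k j x z"
proof -
  obtain c where "c \<in> C" using assms by blast
  define r where "r = smax_power_dist n k j x c"
  define B where "B = (\<Pi>\<^sub>E i\<in>{..<n}. {y. cmod (smax_embed y) \<le> cmod (smax_embed (x i)) + r})"
  show ?thesis
  proof (rule continuous_map_attains_min[OF continuous_map_smax_power_dist assms(1) \<open>c \<in> C\<close>])
    show "compactin (smax_power_topology n) B"
      unfolding B_def smax_power_topology_def compactin_PiE by (simp add: compactin_smax_cball)
    fix y assume "y \<in> C" and le: "smax_power_dist n k j x y \<le> smax_power_dist n k j x c"
    have "cmod (smax_embed (y i)) \<le> cmod (smax_embed (x i)) + r" if "i < n" for i
      using norm_triangle_ineq3[of "smax_embed (x i)" "smax_embed (y i)"] cmod_smax_embed_diff_le[of "x i" "y i" j]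
        smax_dist_le_smax_power_dist[OF that, of j x y k] le
      unfolding r_def by linarith
    moreover have "y \<in> smax_power n"
      using closedin_subset[OF assms(1)] \<open>y \<in> C\<close> by (auto simp: topspace_smax_power_topology)
    ultimately show "y \<in> B" by (auto simp: B_def smax_power_def PiE_iff)
  qed
qed

text \<open>Two nearest points that differ at the index \<open>i\<close> cannot both survive the replacement of their
  \<open>i\<close>-th entry by a point of the connected set \<open>A i\<close> that is nearer to \<open>x i\<close> than one of the two
  entries.\<close>
lemma chebyshev_in_smax_power_if_connectedin:
  assumes closed: "\<And>i. i < n \<Longrightarrow> closedin smax_topology (A i)"
    and nonempty: "\<And>i. i < n \<Longrightarrow> A i \<noteq> {}"
    and conn: "\<And>i. i < n \<Longrightarrow> connectedin smax_topology (A i)"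
  shows "chebyshev_in (smax_power n) (smax_power_dist n k j) (\<Pi>\<^sub>E i\<in>{..<n}. A i)"
  unfolding chebyshev_in_def
proof (intro conjI ballI)
  let ?K = "\<Pi>\<^sub>E i\<in>{..<n}. A i" and ?d = "smax_power_dist n k j"
  show "?K \<subseteq> smax_power n" by (auto simp: smax_power_def)
  fix x
  have proj: "y \<in> metric_projection ?d ?K x \<longleftrightarrow> y \<in> ?K \<and> (\<forall>z\<in>?K. ?d x y \<le> ?d x z)" for y
    by (rule mem_metric_projection_iff) (rule smax_power_dist_nonneg)
  have "closedin (smax_power_topology n) ?K"
    using closed by (simp add: smax_power_topology_def closedin_product_topology)
  moreover have "?K \<noteq> {}"
    using nonempty by (simp add: PiE_eq_empty_iff)
  ultimately obtain y where y: "y \<in> metric_projection ?d ?K x"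
    using smax_power_dist_attains_min proj by meson
  have "z = y" if z: "z \<in> metric_projection ?d ?K x" for z
  proof (rule ccontr)
    assume "z \<noteq> y"
    then obtain i where i: "i < n" "y i \<noteq> z i"
      using y z proj PiE_ext[of z "{..<n}" A y] by (metis lessThan_iff)
    have "y i \<in> A i" "z i \<in> A i" using y z proj i by (auto simp: PiE_iff)
    then obtain m where m: "m \<in> A i" "smax_dist j (x i) m < smax_dist j (x i) (y i)
        \<or> smax_dist j (x i) m < smax_dist j (x i) (z i)"
      using nearer_point_in_connectedin[OF conn[OF i(1)] _ _ i(2)] by blast
    have "w(i := m) \<in> ?K" if "w \<in> ?K" for w
      using that m i by (auto simp: PiE_iff extensional_def)
    then have "\<not> smax_dist j (x i) m < smax_dist j (x i) (w i)" if "w \<in> metric_projection ?d ?K x" for w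
      using smax_power_dist_upd_less[OF i(1), of j x m w k] that proj by (meson not_le)
    then show False using m y z by blast
  qed
  with y show "is_singleton (metric_projection ?d ?K x)"
    by (auto simp: is_singleton_def)
qed

section \<open>Chebyshev products\<close>

theorem theorem85:
  fixes n j k :: nat and A :: "nat \<Rightarrow> smax set"
  assumes "n > 0"
    and "j \<in> {1, 2}" and "k \<in> {1, 2}"
    and "\<And>i. i < n \<Longrightarrow> A i \<noteq> {}"
    and "\<And>i. i < n \<Longrightarrow> closedin smax_topology (A i)"
  shows "chebyshev_in (smax_power n) (smax_power_dist n k j) (\<Pi>\<^sub>E i\<in>{..<n}. A i)
    \<longleftrightarrow> connectedin (smax_power_topology n) (\<Pi>\<^sub>E i\<in>{..<n}. A i)"
proof
  assume "connectedin (smax_power_topology n) (\<Pi>\<^sub>E i\<in>{..<n}. A i)"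
  then have "connectedin smax_topology (A i)" if "i < n" for i
    using assms(4) that by (auto simp: smax_power_topology_def connectedin_PiE PiE_eq_empty_iff)
  then show "chebyshev_in (smax_power n) (smax_power_dist n k j) (\<Pi>\<^sub>E i\<in>{..<n}. A i)"
    using assms(4,5) by (intro chebyshev_in_smax_power_if_connectedin) auto
next
  assume "chebyshev_in (smax_power n) (smax_power_dist n k j) (\<Pi>\<^sub>E i\<in>{..<n}. A i)"
  then show "connectedin (smax_power_topology n) (\<Pi>\<^sub>E i\<in>{..<n}. A i)"
  proof (intro connectedin_if_chebyshev_in[where d = "smax_power_dist n k j"])
    show "connected_space (smax_power_topology n)"
      by (simp add: smax_power_topology_def connected_space_product_topology connected_space_smax)
    show "closedin (smax_power_topology n) (\<Pi>\<^sub>E i\<in>{..<n}. A i)"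
      using assms(5) by (simp add: smax_power_topology_def closedin_product_topology)
  qed (simp_all add: continuous_map_smax_power_dist smax_power_dist_nonneg smax_power_dist_refl
      smax_power_dist_sym smax_power_dist_triangle smax_power_dist_attains_min topspace_smax_power_topology)
qed

end
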